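(* Let $G$ be a simple graph on $n$ vertices with $m$ edges, and suppose $G$ admits an $\varepsilon$-factorization via $(H,K,E)$. Then \[ \varepsilon\ge \max\left\{0,\ \frac{2m-n\,\Delta(H)\Delta(K)}{n^2}\right\}. \]
   Context: All graphs are finite, simple and undirected; $A(H)$ is the adjacency matrix of $H$ and $\Delta(H)$ its maximum degree. Let $0\le \varepsilon\le 1$. Fix an ordering $v_1,\dots,v_n$ of $V(G)$. $G$ admits an $\varepsilon$-factorization via $(H,K,E)$ means: $H$ and $K$ are simple graphs on $V(G)$, $E\in\{0,1\}^{n\times n}$ has at most $\varepsilon n^2$ nonzero entries, and $(A(H)A(K))_{ij}=A(G)_{ij}$ for every $(i,j)$ with $E_{ij}=0$. *)

theory Defs
  imports "Graph_Theory.Pair_Digraph" "Jordan_Normal_Form.Matrix"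
begin

text \<open>
  A finite simple undirected graph is a \<^locale>\<open>pair_graph\<close>: a finite, loop-free digraph
  whose arcs form a symmetric relation. Each undirected edge thus occurs as two opposite
  arcs, so undirected edges are counted as two-element vertex sets.
\<close>

definition edges :: "'a pair_pre_digraph \<Rightarrow> 'a set set" where
  "edges G = {{u, v} | u v. (u, v) \<in> parcs G}"

definition degree :: "'a pair_pre_digraph \<Rightarrow> 'a \<Rightarrow> nat" where
  "degree G v = card {u \<in> pverts G. (v, u) \<in> parcs G}"

text \<open>The value is meaningful only for graphs with at least one vertex.\<close>

definition max_degree :: "'a pair_pre_digraph \<Rightarrow> nat" where
  "max_degree G = Max (degree G ` pverts G)"

definition vertex_ordering :: "'a pair_pre_digraph \<Rightarrow> 'a list \<Rightarrow> bool" where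
  "vertex_ordering G vs \<longleftrightarrow> distinct vs \<and> set vs = pverts G"

text \<open>Matrix indices start at 0, so row and column \<open>i\<close> belong to the vertex \<open>vs ! i\<close>.\<close>

definition adj_matrix :: "'a list \<Rightarrow> 'a pair_pre_digraph \<Rightarrow> real mat" where
  "adj_matrix vs G = mat (length vs) (length vs)
     (\<lambda>(i, j). if (vs ! i, vs ! j) \<in> parcs G then 1 else 0)"

definition eps_factorization ::
  "real \<Rightarrow> 'a list \<Rightarrow> 'a pair_pre_digraph \<Rightarrow> 'a pair_pre_digraph \<Rightarrow> 'a pair_pre_digraph
    \<Rightarrow> real mat \<Rightarrow> bool" where
  "eps_factorization \<epsilon> vs G H K E \<longleftrightarrow>
     (let n = card (pverts G) in
       pair_graph H \<and> pverts H = pverts G \<and>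
       pair_graph K \<and> pverts K = pverts G \<and>
       E \<in> carrier_mat n n \<and>
       (\<forall>i<n. \<forall>j<n. E $$ (i, j) \<in> {0, 1}) \<and>
       real (card {(i, j). i < n \<and> j < n \<and> E $$ (i, j) \<noteq> 0}) \<le> \<epsilon> * real n ^ 2 \<and>
       (\<forall>i<n. \<forall>j<n. E $$ (i, j) = 0 \<longrightarrow>
          (adj_matrix vs H * adj_matrix vs K) $$ (i, j) = adj_matrix vs G $$ (i, j)))"

end

theory Submission
  imports Defs
begin

text \<open>
  The arcs of \<open>G\<close> number \<open>2m\<close>, since each edge contributes both of its orientations. An arc
  \<open>(u, v)\<close> sits either at a nonzero entry of \<open>E\<close>, and there are at most \<open>\<epsilon>n\<^sup>2\<close> of those,
  or at a position where the matrix product agrees with the adjacency matrix of \<open>G\<close>. In the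
  second case the product has entry \<open>1\<close>, so at least one summand of that entry is nonzero, and
  this summand names a vertex \<open>w\<close> with \<open>u \<rightarrow> w\<close> in \<open>H\<close> and \<open>w \<rightarrow> v\<close> in \<open>K\<close>
  (\<open>relcomp_if_adj_matrix_product_nonzero\<close>).
  Such pairs \<open>(u, v)\<close> are endpoints of two-step walks, of which there are at most
  \<open>n \<Delta>(H) \<Delta>(K)\<close>: choose \<open>u\<close>, then \<open>w\<close>, then \<open>v\<close>
  (\<open>card_relcomp_parcs_le\<close>). Hence
  \<open>2m \<le> \<epsilon>n\<^sup>2 + n \<Delta>(H) \<Delta>(K)\<close>, and dividing by \<open>n\<^sup>2\<close> gives the bound.
\<close>

text \<open>
  Grouping the arcs by their underlying edge gives fibres of size two: symmetry puts both
  orientations of an edge into the fibre, and looplessness makes them different.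
\<close>

lemma card_parcs_eq_twice_card_edges:
  assumes "pair_graph G"
  shows "card (parcs G) = 2 * card (edges G)"
proof -
  interpret pair_graph G by fact
  let ?ends = "\<lambda>(u, v). {u, v}"
  have edges_image: "edges G = ?ends ` parcs G"
    unfolding edges_def by force
  have fibre: "card {a \<in> parcs G. ?ends a = e} = 2" if "e \<in> edges G" for e
  proof -
    from that obtain u v where e: "e = {u, v}" and uv: "(u, v) \<in> parcs G"
      unfolding edges_def by blast
    from uv have vu: "(v, u) \<in> parcs G"
      using arcs_symmetric by blast
    from uv have "u \<noteq> v"
      using no_loops' by blast
    have ends: "?ends a = e \<longleftrightarrow> a = (u, v) \<or> a = (v, u)" for a
      by (cases a) (simp add: e doubleton_eq_iff)
    have "{a \<in> parcs G. ?ends a = e} = {(u, v), (v, u)}"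
      unfolding ends using uv vu by blast
    with \<open>u \<noteq> v\<close> show ?thesis by simp
  qed
  have "card (parcs G) = (\<Sum>e\<in>edges G. card {a \<in> parcs G. ?ends a = e})"
    using sum.image_gen[OF pair_finite_arcs, of "\<lambda>_. 1::nat" ?ends]
    by (simp add: edges_image)
  then show ?thesis
    by (simp add: fibre)
qed

lemma degree_le_max_degree:
  assumes "finite (pverts G)" and "v \<in> pverts G"
  shows "degree G v \<le> max_degree G"
  using assms unfolding max_degree_def by simp

text \<open>
  Each pair on the left is the pair of endpoints of at least one walk \<open>u \<rightarrow> w \<rightarrow> v\<close>, so it
  suffices to bound the number of walks. For fixed \<open>u\<close> there are \<open>degree H u\<close> choices
  of \<open>w\<close>, and then \<open>degree K w\<close> choices of \<open>v\<close>.
\<close>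

lemma card_relcomp_parcs_le:
  assumes H: "pair_graph H" and K: "pair_graph K" and verts: "pverts K = pverts H"
  shows "card (parcs H O parcs K) \<le> card (pverts H) * max_degree H * max_degree K"
proof -
  interpret H: pair_graph H by fact
  interpret K: pair_graph K by fact
  let ?N = "\<lambda>G u. {w \<in> pverts G. (u, w) \<in> parcs G}"
  let ?walks = "SIGMA u : pverts H. SIGMA w : ?N H u. ?N K w"
  have "parcs H O parcs K \<subseteq> (\<lambda>(u, w, v). (u, v)) ` ?walks"
  proof
    fix a assume "a \<in> parcs H O parcs K"
    then obtain u w v where a: "a = (u, v)" and uw: "(u, w) \<in> parcs H" and wv: "(w, v) \<in> parcs K"
      by blast
    from uw wv have "(u, w, v) \<in> ?walks"
      using H.in_arcsD1[OF uw] H.in_arcsD2[OF uw] K.in_arcsD2[OF wv] by simp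
    then show "a \<in> (\<lambda>(u, w, v). (u, v)) ` ?walks"
      unfolding a by (rule rev_image_eqI) simp
  qed
  then have "card (parcs H O parcs K) \<le> card ?walks"
    by (intro surj_card_le finite_SigmaI) simp_all
  also have "\<dots> = (\<Sum>u\<in>pverts H. \<Sum>w\<in>?N H u. degree K w)"
    by (simp add: degree_def)
  also have "\<dots> \<le> (\<Sum>u\<in>pverts H. \<Sum>w\<in>?N H u. max_degree K)"
    using verts by (intro sum_mono degree_le_max_degree) auto
  also have "\<dots> = (\<Sum>u\<in>pverts H. degree H u * max_degree K)"
    by (simp add: degree_def)
  also have "\<dots> \<le> (\<Sum>u\<in>pverts H. max_degree H * max_degree K)"
    by (intro sum_mono mult_right_mono degree_le_max_degree) auto
  also have "\<dots> = card (pverts H) * max_degree H * max_degree K"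
    by simp
  finally show ?thesis .
qed

lemma relcomp_if_adj_matrix_product_nonzero:
  assumes ij: "i < length vs" "j < length vs"
    and nonzero: "(adj_matrix vs H * adj_matrix vs K) $$ (i, j) \<noteq> 0"
  shows "(vs ! i, vs ! j) \<in> parcs H O parcs K"
proof -
  have "(adj_matrix vs H * adj_matrix vs K) $$ (i, j) =
      (\<Sum>k<length vs. adj_matrix vs H $$ (i, k) * adj_matrix vs K $$ (k, j))"
    using ij by (simp add: adj_matrix_def scalar_prod_def atLeast0LessThan)
  with nonzero obtain k where "k < length vs"
    and "adj_matrix vs H $$ (i, k) * adj_matrix vs K $$ (k, j) \<noteq> 0"
    by (metis (no_types, lifting) lessThan_iff sum.neutral)
  with ij show ?thesis
    by (auto simp: adj_matrix_def split: if_splits)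
qed

theorem theorem2:
  fixes G H K :: "'a pair_pre_digraph"
    and vs :: "'a list"
    and E :: "real mat"
    and \<epsilon> :: real
    and n m :: nat
  assumes "0 \<le> \<epsilon>" and "\<epsilon> \<le> 1"
    and "pair_graph G"
    and "n = card (pverts G)"
    and "m = card (edges G)"
    and "vertex_ordering G vs"
    and "eps_factorization \<epsilon> vs G H K E"
  shows "\<epsilon> \<ge> max 0 ((2 * real m - real n * real (max_degree H) * real (max_degree K)) / real n ^ 2)"
proof (cases "n = 0")
  case True
  \<comment> \<open>Here the quotient has denominator \<open>0\<close> and hence the value \<open>0\<close>.\<close>
  with \<open>0 \<le> \<epsilon>\<close> show ?thesis by simp
next
  case False
  interpret G: pair_graph G by fact
  have H: "pair_graph H" "pverts H = pverts G" and K: "pair_graph K" "pverts K = pverts G"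
    using assms(7) by (simp_all add: eps_factorization_def Let_def)
  interpret H: pair_graph H by fact
  interpret K: pair_graph K by fact
  have vs: "set vs = pverts G" and length_vs: "length vs = n"
    using assms(4,6) distinct_card[of vs] by (auto simp: vertex_ordering_def)
  note factorization = assms(7)[unfolded eps_factorization_def Let_def, folded assms(4)]
  let ?bad = "{(i, j). i < n \<and> j < n \<and> E $$ (i, j) \<noteq> 0}"
  let ?vertices = "\<lambda>(i, j). (vs ! i, vs ! j)"
  have bad_le: "real (card ?bad) \<le> \<epsilon> * real n ^ 2"
    using factorization by (elim conjE)
  have agree: "(adj_matrix vs H * adj_matrix vs K) $$ (i, j) = adj_matrix vs G $$ (i, j)"
      if "i < n" "j < n" "E $$ (i, j) = 0" for i j
    using factorization that by (elim conjE) simp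
  have finite_bad: "finite ?bad"
    by (rule finite_subset[of _ "{..<n} \<times> {..<n}"]) auto
  have finite_comp: "finite (parcs H O parcs K)"
    by (intro finite_relcomp H.pair_finite_arcs K.pair_finite_arcs)
  have "parcs G \<subseteq> ?vertices ` ?bad \<union> parcs H O parcs K"
  proof
    fix a assume a: "a \<in> parcs G"
    then have "fst a \<in> set vs" "snd a \<in> set vs"
      unfolding vs by (rule G.arc_fst_in_verts G.arc_snd_in_verts)+
    then obtain i j where ij: "i < n" "j < n" and "vs ! i = fst a" "vs ! j = snd a"
      unfolding in_set_conv_nth length_vs by blast
    then have a_eq: "a = (vs ! i, vs ! j)"
      by simp
    show "a \<in> ?vertices ` ?bad \<union> parcs H O parcs K"
    proof (cases "E $$ (i, j) = 0")
      case True
      have "(adj_matrix vs H * adj_matrix vs K) $$ (i, j) = 1"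
        using agree[OF ij True] ij a by (simp add: adj_matrix_def length_vs a_eq)
      then have "a \<in> parcs H O parcs K"
        using relcomp_if_adj_matrix_product_nonzero[of i vs j H K] ij
        by (simp add: length_vs a_eq)
      then show ?thesis ..
    next
      case False
      with ij show ?thesis by (force simp: a_eq)
    qed
  qed
  then have "card (parcs G) \<le> card (?vertices ` ?bad \<union> parcs H O parcs K)"
    using finite_bad finite_comp by (intro card_mono) auto
  also have "\<dots> \<le> card ?bad + card (parcs H O parcs K)"
    using card_Un_le[of "?vertices ` ?bad"] card_image_le[OF finite_bad, of ?vertices]
    by (meson add_right_mono order_trans)
  also have "\<dots> \<le> card ?bad + n * max_degree H * max_degree K"
    using card_relcomp_parcs_le[of H K] H K by (simp add: assms(4))
  finally have "2 * m \<le> card ?bad + n * max_degree H * max_degree K"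
    by (simp add: card_parcs_eq_twice_card_edges[OF assms(3)] assms(5))
  then have "real (2 * m) \<le> real (card ?bad + n * max_degree H * max_degree K)"
    by (rule of_nat_mono)
  then have "2 * real m - real n * real (max_degree H) * real (max_degree K) \<le> \<epsilon> * real n ^ 2"
    using bad_le by simp
  with \<open>n \<noteq> 0\<close> \<open>0 \<le> \<epsilon>\<close> show ?thesis
    by (simp add: pos_divide_le_eq)
qed

end
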